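(* Let $f(x)\in\mathbb{Z}[x]$ be monic with $\deg f(x)=n<m$, where $m$ is a positive integer, and let $q_1,\dots,q_m\in\mathbb{Z}$. Then the equation $$(y+q_1)(y+q_2)\cdots(y+q_m)=f(x)$$ has finitely many solutions $(x,y)$ in integers if and only if $|x-y|$ is bounded for all integer solutions $(x,y)$, i.e. there is a constant $C$ such that $|x-y|\le C$ for every integer solution $(x,y)$ of the equation. *)

theory Defs
  imports Complex_Main "HOL-Computational_Algebra.Polynomial"
begin

end

theory Submission imports Defs
begin

text \<open>A finite solution set trivially bounds \<open>\<bar>x - y\<bar>\<close>. Conversely, a
  bound on \<open>\<bar>x - y\<bar>\<close> leaves finitely many integer values \<open>k\<close> of
  \<open>x - y\<close>, so the solutions lie on finitely many lines \<open>y = x - k\<close>. On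
  each line the equation becomes a polynomial equation in \<open>x\<close> whose two sides have
  degrees \<open>m\<close> and \<open>n < m\<close>, so it has finitely many roots
  (\<open>finite_solutions_on_line\<close>).\<close>

lemma degree_prod_linear:
  fixes a :: "nat \<Rightarrow> 'a::idom"
  shows "degree (\<Prod>i=1..m. [:a i, 1:]) = m"
  by (subst degree_prod_eq_sum_degree) auto

text \<open>After substituting \<open>y = x - k\<close>, the left side is a polynomial in
  \<open>x\<close> of degree \<open>m\<close> by \<open>degree_prod_linear\<close>. It cannot equal
  \<open>f\<close>, whose degree is smaller, so the difference \<open>g\<close> is a nonzero
  polynomial over an integral domain and has finitely many roots.\<close>

lemma finite_solutions_on_line:
  fixes f :: "'a::idom poly"
  assumes "degree f < m"
  shows "finite {x. (\<Prod>i=1..m. x - k + q i) = poly f x}"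
proof -
  define g where "g = (\<Prod>i=1..m. [:q i - k, 1:]) - f"
  have "g \<noteq> 0"
    using assms degree_prod_linear[of "\<lambda>i. q i - k" m] by (auto simp: g_def)
  moreover have "{x. (\<Prod>i=1..m. x - k + q i) = poly f x} = {x. poly g x = 0}"
    by (simp add: g_def poly_prod algebra_simps)
  ultimately show ?thesis
    by (simp add: poly_roots_finite)
qed

theorem theorem1p3:
  fixes f :: "int poly" and q :: "nat \<Rightarrow> int" and n m :: nat
  assumes "lead_coeff f = 1"
    and "degree f = n"
    and "n < m"
    and "0 < m"
  shows "finite {(x :: int, y :: int). (\<Prod>i=1..m. y + q i) = poly f x} \<longleftrightarrow>
         (\<exists>C::real. \<forall>x y :: int. (\<Prod>i=1..m. y + q i) = poly f x \<longrightarrow> real_of_int \<bar>x - y\<bar> \<le> C)"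
    (is "finite ?S \<longleftrightarrow> ?bounded")
proof
  assume "finite ?S"
  then have "bdd_above ((\<lambda>(x, y). real_of_int \<bar>x - y\<bar>) ` ?S)"
    by (intro bdd_above_finite finite_imageI)
  then show ?bounded
    by (fastforce simp: bdd_above_def)
next
  assume ?bounded
  then obtain C :: real
    where C: "\<And>x y. (\<Prod>i=1..m. y + q i) = poly f x \<Longrightarrow> real_of_int \<bar>x - y\<bar> \<le> C"
    by blast
  \<comment> \<open>The solutions on the line \<open>y = x - k\<close>, parametrized by
    \<open>x\<close>.\<close>
  let ?line = "\<lambda>k. (\<lambda>x. (x, x - k)) ` {x. (\<Prod>i=1..m. x - k + q i) = poly f x}"
  have "?S \<subseteq> (\<Union>k\<in>{-\<lfloor>C\<rfloor>..\<lfloor>C\<rfloor>}. ?line k)"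
  proof clarify
    fix x y assume sol: "(\<Prod>i=1..m. y + q i) = poly f x"
    \<comment> \<open>Since \<open>\<bar>x - y\<bar>\<close> is an integer, the real bound
      \<open>C\<close> can be rounded down, which makes the range of \<open>k\<close> a finite
      integer interval.\<close>
    then have "\<bar>x - y\<bar> \<le> \<lfloor>C\<rfloor>"
      using C by (simp add: le_floor_iff)
    then have "x - y \<in> {-\<lfloor>C\<rfloor>..\<lfloor>C\<rfloor>}"
      by auto
    moreover have "(x, y) \<in> ?line (x - y)"
      using sol by (intro image_eqI[of _ _ x]) auto
    ultimately show "(x, y) \<in> (\<Union>k\<in>{-\<lfloor>C\<rfloor>..\<lfloor>C\<rfloor>}. ?line k)"
      by blast
  qed
  moreover have "finite (\<Union>k\<in>{-\<lfloor>C\<rfloor>..\<lfloor>C\<rfloor>}. ?line k)"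
    using assms by (intro finite_UN_I finite_imageI finite_solutions_on_line) auto
  ultimately show "finite ?S"
    by (rule finite_subset)
qed

end
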